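(* Let $D\subseteq X$ be a nonempty convex set and let $A,B:(D-D)\to\mathscr{P}_0(Y)$ be such that the values of the set-valued map $B$ are closedly $K$-convex, where $K:=\overline{\mathrm{rec}}(B)$. Let $F:D\to\mathscr{P}_0(Y)$ be a set-valued map which satisfies $$\frac{F(x)+F(y)}{2}+A(x-y)\subseteq \mathrm{cl}\Big(F\Big(\frac{x+y}{2}\Big)+B(x-y)\Big)\qquad (x,y\in D).$$ Then, for all $x,y\in D$ and $t\in\mathbb{D}\cap[0,1]$, $$tF(x)+(1-t)F(y)+\sum_{k=0}^{\infty}2d_{\mathbb{Z}}(2^kt)A\Big(\frac{x-y}{2^k}\Big)\subseteq \mathrm{cl}\Big(F(tx+(1-t)y)+\sum_{k=0}^{\infty}2d_{\mathbb{Z}}(2^kt)B\Big(\frac{x-y}{2^k}\Big)\Big).$$ If, in addition, $0\in\mathrm{cl}(A(u)+K)$ for every $u\in D-D$, then $$tF(x)+(1-t)F(y)+A^\perp(t,x-y)\subseteq \mathrm{cl}\big(F(tx+(1-t)y)+B^\perp(t,x-y)\big)\qquad (x,y\in D,\ t\in\mathbb{D}\cap[0,1]).$$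
   Context: $X$ is a real linear space and $Y$ is a real Hausdorff topological vector space. $\mathscr{P}_0(Y)$ is the family of nonempty subsets of $Y$; $\mathrm{cl}$ is the closure in $Y$. Sums and scalar multiples of sets are in the Minkowski sense (so $0\cdot S=\{0\}$ for nonempty $S$), and $D-D=\{x-y: x,y\in D\}$. $\mathbb{D}$ is the set of diadic rationals $k/2^n$, $k\in\mathbb{Z}$, $n\in\mathbb{N}$, and $d_{\mathbb{Z}}(t):=\inf_{k\in\mathbb{Z}}|k-t|$. For $t\in\mathbb{D}$, $d_{\mathbb{Z}}(2^kt)=0$ for all large $k$, so the infinite sums of sets in the claim are in fact finite sums. Recession cones: for nonempty $S\subseteq Y$, $\mathrm{rec}(S):=\{y\in Y: ty+S\subseteq S \text{ for all } t\ge 0\}$. For a set-valued map $B$ on $D-D$, $\mathrm{rec}(B):=\bigcap_{u\in D-D}\mathrm{rec}(B(u))$, and $\overline{\mathrm{rec}}(B)$ is the closure of $\mathrm{rec}(B)$ (a convex cone containing $0$). For a convex cone $K\subseteq Y$, a set $S\subseteq Y$ is closedly $K$-convex if $tS+(1-t)S\subseteq\mathrm{cl}(S+K)$ for all $t\in[0,1]$. Tabor transformation: for a set-valued map $S:D-D\to\mathscr{P}_0(Y)$, $$S^\perp(t,u):=\mathrm{cl}\Big(\bigcup_{n=0}^\infty\sum_{k=0}^n 2d_{\mathbb{Z}}(2^kt)\,S\Big(\frac{u}{2^k}\Big)\Big)\qquad (t\in\mathbb{R},\ u\in D-D).$$ *)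

theory Defs
  imports "HOL-Analysis.Analysis" "HOL-Library.Set_Algebras" "HOL-Library.Groups_Big_Fun"
begin

text \<open>
  Sums of sets are the Minkowski sums of \<^theory>\<open>HOL-Library.Set_Algebras\<close>; in particular the
  neutral element \<^term>\<open>0 :: 'a::real_vector set\<close> is \<open>{0}\<close>. The scalar multiple \<open>c S\<close> is the
  image \<open>(*\<^sub>R) c ` S\<close>. In contrast, \<open>-\<close> on sets is set-theoretic difference, whence
  \<open>difference_set\<close> below.
\<close>

text \<open>
  Real topological vector spaces. Hausdorff spaces are obtained by adding the
  sort \<^class>\<open>t2_space\<close>.
\<close>

class real_tvs = real_vector + topological_ab_group_add +
  assumes tendsto_scaleR_Pair:
    "LIM p (nhds c \<times>\<^sub>F nhds x). fst p *\<^sub>R snd p :> nhds (c *\<^sub>R x)"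

instance real_normed_vector \<subseteq> real_tvs
proof
  fix c :: real and x :: 'a
  show "LIM p (nhds c \<times>\<^sub>F nhds x). fst p *\<^sub>R snd p :> nhds (c *\<^sub>R x)"
    by (intro tendsto_scaleR filterlim_fst filterlim_snd)
qed

definition difference_set :: "'a::real_vector set \<Rightarrow> 'a set" where
  "difference_set D = {x - y |x y. x \<in> D \<and> y \<in> D}"

definition dyadic_rationals :: "real set" where
  "dyadic_rationals = {of_int k / 2 ^ n |(k::int) (n::nat). True}"

definition dist_int :: "real \<Rightarrow> real" where
  "dist_int t = (INF k::int. \<bar>of_int k - t\<bar>)"

definition rec_cone :: "'b::real_vector set \<Rightarrow> 'b set" where
  "rec_cone S = {y. \<forall>t\<ge>0. t *\<^sub>R y +o S \<subseteq> S}"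

text \<open>The common recession cone of the values of a set-valued map with domain \<open>U\<close>.\<close>

definition rec_map :: "'a set \<Rightarrow> ('a \<Rightarrow> 'b::real_vector set) \<Rightarrow> 'b set" where
  "rec_map U B = (\<Inter>u\<in>U. rec_cone (B u))"

definition closedly_convex :: "'b::real_tvs set \<Rightarrow> 'b set \<Rightarrow> bool" where
  "closedly_convex K S \<longleftrightarrow>
     (\<forall>t\<in>{0..1}. (*\<^sub>R) t ` S + (*\<^sub>R) (1 - t) ` S \<subseteq> closure (S + K))"

definition tabor_term ::
    "('a::real_vector \<Rightarrow> 'b::real_vector set) \<Rightarrow> real \<Rightarrow> 'a \<Rightarrow> nat \<Rightarrow> 'b set" where
  "tabor_term S t u k = (*\<^sub>R) (2 * dist_int (2 ^ k * t)) ` S (u /\<^sub>R 2 ^ k)"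

text \<open>
  The infinite sum of sets. \<^const>\<open>Sum_any\<close> adds up the terms different from \<open>{0}\<close>, and it is
  meaningful only if there are finitely many of them. This holds for dyadic \<open>t\<close> and
  nonempty values of \<open>S\<close>, since then \<open>dist_int (2 ^ k * t) = 0\<close> for all large \<open>k\<close>.
\<close>

definition tabor_series ::
    "('a::real_vector \<Rightarrow> 'b::real_vector set) \<Rightarrow> real \<Rightarrow> 'a \<Rightarrow> 'b set" where
  "tabor_series S t u = Sum_any (tabor_term S t u)"

definition tabor_transform ::
    "('a::real_vector \<Rightarrow> 'b::real_tvs set) \<Rightarrow> real \<Rightarrow> 'a \<Rightarrow> 'b set" where
  "tabor_transform S t u = closure (\<Union>n. \<Sum>k\<le>n. tabor_term S t u k)"

lemma dist_int_eq_0: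
  assumes "t \<in> \<int>"
  shows "dist_int t = 0"
proof -
  obtain m where m: "t = of_int m"
    using assms by (auto elim: Ints_cases)
  have "dist_int t \<le> \<bar>of_int m - t\<bar>"
    unfolding dist_int_def by (rule cINF_lower) (auto intro!: bdd_belowI[where m = 0])
  moreover have "0 \<le> dist_int t"
    unfolding dist_int_def by (rule cINF_greatest) auto
  ultimately show ?thesis
    using m by simp
qed

lemma finite_tabor_support:
  fixes S :: "'a::real_vector \<Rightarrow> 'b::real_vector set"
  assumes "t \<in> dyadic_rationals" and "\<And>k::nat. S (u /\<^sub>R 2 ^ k) \<noteq> {}"
  shows "finite {k. tabor_term S t u k \<noteq> 0}"
proof -
  obtain m :: int and n :: nat where t: "t = of_int m / 2 ^ n"
    using assms(1) by (auto simp: dyadic_rationals_def)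
  have "tabor_term S t u k = 0" if "n \<le> k" for k
  proof -
    have "(2::real) ^ k = 2 ^ (k - n) * 2 ^ n"
      using that by (simp flip: power_add)
    then have "2 ^ k * t = of_int (2 ^ (k - n) * m)"
      by (simp add: t)
    then have "dist_int (2 ^ k * t) = 0"
      by (metis Ints_of_int dist_int_eq_0)
    then show ?thesis
      using assms(2)[of k] by (auto simp: tabor_term_def)
  qed
  then have "{k. tabor_term S t u k \<noteq> 0} \<subseteq> {..<n}"
    by (auto simp: not_le[symmetric] simp del: set_zero)
  then show ?thesis
    using finite_subset by blast
qed

end

theory Submission
  imports Defs
begin

text \<open>
  The first inclusion is proved by induction on the exponent \<open>n\<close> of the denominator of \<open>t\<close>.
  If \<open>t\<close> is the midpoint of two neighbours \<open>t\<^sub>1, t\<^sub>2\<close> with denominator \<open>2 ^ n\<close>, the two points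
  \<open>t\<^sub>i x + (1 - t\<^sub>i) y\<close> differ by \<open>(x - y) / 2 ^ n\<close>, and the assumed inclusion for them contributes
  exactly the new terms for \<open>k = n\<close>, whose coefficient is \<open>1\<close>. For \<open>k < n\<close> the function
  \<open>s \<mapsto> dist_int (2 ^ k s)\<close> is affine on \<open>[t\<^sub>1, t\<^sub>2]\<close>, so the terms of the two sums can be averaged;
  on the right-hand side this costs a summand \<open>K\<close> for each \<open>k\<close> by closed \<open>K\<close>-convexity, and all of
  them are absorbed by the term \<open>B ((x - y) / 2 ^ n)\<close>.

  The second inclusion is the first one for \<open>closure (A u + K)\<close> in place of \<open>A u\<close>: these sets contain
  \<open>0\<close>, so their partial sums increase.
\<close>

subsection \<open>Minkowski operations and closures\<close>

lemma scaleR_image_plus: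
  fixes S T :: "'b::real_vector set"
  shows "(*\<^sub>R) c ` (S + T) = (*\<^sub>R) c ` S + (*\<^sub>R) c ` T"
  by (force simp: set_plus_def scaleR_add_right image_iff)

lemma scaleR_image_zero: "(*\<^sub>R) c ` (0 :: 'b::real_vector set) = 0"
  by (simp add: set_zero)

lemma zero_scaleR_image:
  fixes S :: "'b::real_vector set"
  assumes "S \<noteq> {}"
  shows "(*\<^sub>R) 0 ` S = 0"
  using assms by (auto simp: set_zero)

lemma scaleR_image_sum:
  fixes S :: "'i \<Rightarrow> 'b::real_vector set"
  shows "(*\<^sub>R) c ` (\<Sum>i\<in>I. S i) = (\<Sum>i\<in>I. (*\<^sub>R) c ` S i)"
  by (induction I rule: infinite_finite_induct)
    (simp_all add: scaleR_image_zero scaleR_image_plus del: set_zero)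

lemma scaleR_image_scaleR: "(*\<^sub>R) c ` (*\<^sub>R) d ` S = (*\<^sub>R) (c * d) ` (S :: 'b::real_vector set)"
  by (simp add: image_image)

text \<open>Only one inclusion holds in general, because the right-hand side may combine two
  different points of \<open>S\<close>. It serves to split the sets on the left of the main
  inclusion; the opposite direction, wanted for \<open>B\<close>, is what closed convexity
  supplies.\<close>

lemma scaleR_add_image_subset:
  "(*\<^sub>R) (c + d) ` S \<subseteq> (*\<^sub>R) c ` S + (*\<^sub>R) d ` (S :: 'b::real_vector set)"
  by (auto simp: scaleR_add_left intro!: set_plus_intro)

lemma sum_set_mono:
  fixes S T :: "'i \<Rightarrow> 'b::comm_monoid_add set"
  assumes "\<And>i. i \<in> I \<Longrightarrow> S i \<subseteq> T i"
  shows "(\<Sum>i\<in>I. S i) \<subseteq> (\<Sum>i\<in>I. T i)"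
  using assms
  by (induction I rule: infinite_finite_induct) (simp_all add: set_plus_mono2 del: set_zero)

text \<open>Choosing \<open>0\<close> from every additional summand embeds the shorter sum in the
  longer one.\<close>

lemma sum_set_subset_superset:
  fixes S :: "'i \<Rightarrow> 'b::comm_monoid_add set"
  assumes "finite J" "I \<subseteq> J" "\<And>i. i \<in> J - I \<Longrightarrow> 0 \<in> S i"
  shows "(\<Sum>i\<in>I. S i) \<subseteq> (\<Sum>i\<in>J. S i)"
proof -
  have "(\<Sum>i\<in>I. S i) = (\<Sum>i\<in>J. if i \<in> I then S i else 0)"
    using assms(1,2) by (simp add: sum.inter_restrict[symmetric] Int_absorb1 del: set_zero)
  also have "\<dots> \<subseteq> (\<Sum>i\<in>J. S i)"
    using assms(3) by (intro sum_set_mono) (auto simp: set_zero)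
  finally show ?thesis .
qed

lemma subset_closure_trans: "S \<subseteq> closure T \<Longrightarrow> T \<subseteq> closure U \<Longrightarrow> S \<subseteq> closure U"
  using closure_minimal by blast

text \<open>Addition is continuous on the product space, and the closure of a product is the product
  of the closures.\<close>

lemma plus_subset_closure:
  fixes S T S' T' :: "'b::topological_monoid_add set"
  assumes "S \<subseteq> closure S'" "T \<subseteq> closure T'"
  shows "S + T \<subseteq> closure (S' + T')"
proof -
  have "(\<lambda>(x, y). x + y) ` closure (S' \<times> T') \<subseteq> closure ((\<lambda>(x, y). x + y) ` (S' \<times> T'))"
    by (rule image_closure_subset)
      (auto simp: case_prod_unfold closure_subset intro!: continuous_intros)
  then show ?thesis
    using set_plus_mono2[OF assms] by (simp add: set_plus_image closure_Times)
qed

lemma continuous_on_scaleR_tvs: "continuous_on UNIV ((*\<^sub>R) c :: 'b::real_tvs \<Rightarrow> 'b)"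
proof -
  have "((*\<^sub>R) c \<longlongrightarrow> c *\<^sub>R x) (at x)" for x :: 'b
  proof -
    have "filterlim (\<lambda>y. (c, y)) (nhds c \<times>\<^sub>F nhds x) (at x)"
      by (intro filterlim_Pair tendsto_const tendsto_ident_at)
    from filterlim_compose[OF tendsto_scaleR_Pair this] show ?thesis
      by simp
  qed
  then show ?thesis
    by (simp add: continuous_on_def)
qed

lemma scaleR_subset_closure:
  fixes S T :: "'b::real_tvs set"
  assumes "S \<subseteq> closure T"
  shows "(*\<^sub>R) c ` S \<subseteq> closure ((*\<^sub>R) c ` T)"
proof -
  have "(*\<^sub>R) c ` closure T \<subseteq> closure ((*\<^sub>R) c ` T)"
    by (rule image_closure_subset)
      (auto intro: continuous_on_subset[OF continuous_on_scaleR_tvs] simp: closure_subset)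
  then show ?thesis
    using assms by blast
qed

text \<open>The errors \<open>K\<close> are removed one index at a time: each is moved next to
  \<open>W\<close>, which swallows it up to closure. Thus one absorbing summand pays for all
  \<open>n\<close> terms.\<close>

lemma absorb_sum:
  fixes S T :: "nat \<Rightarrow> 'b::real_tvs set"
  assumes W: "W + K \<subseteq> closure W" and ST: "\<And>k. k < n \<Longrightarrow> S k \<subseteq> closure (T k + K)"
  shows "W + (\<Sum>k<n. S k) \<subseteq> closure (W + (\<Sum>k<n. T k))"
  using ST
proof (induction n)
  case 0
  show ?case by (simp add: closure_subset del: set_zero)
next
  case (Suc n)
  have "W + (\<Sum>k<Suc n. S k) = (W + (\<Sum>k<n. S k)) + S n"
    by (simp only: sum.lessThan_Suc ac_simps)
  also have "\<dots> \<subseteq> closure ((W + (\<Sum>k<n. T k)) + (T n + K))"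
    by (intro plus_subset_closure Suc) (auto simp: Suc.prems)
  also have "(W + (\<Sum>k<n. T k)) + (T n + K) = (W + K) + (\<Sum>k<Suc n. T k)"
    by (simp only: sum.lessThan_Suc ac_simps)
  finally have "W + (\<Sum>k<Suc n. S k) \<subseteq> closure ((W + K) + (\<Sum>k<Suc n. T k))" .
  then show ?case
    by (rule subset_closure_trans[OF _ plus_subset_closure[OF W closure_subset]])
qed

subsection \<open>Recession cones\<close>

text \<open>Each property is immediate for \<open>rec_map U B\<close> itself and passes to its
  closure by continuity of addition and scaling; this is why absorption by \<open>B u\<close> is
  stated up to closure.\<close>

lemma closure_rec_map:
  fixes B :: "'a \<Rightarrow> 'b::real_tvs set"
  assumes K: "K = closure (rec_map U B)"
  shows zero_in_closure_rec_map: "0 \<in> K"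
    and scaleR_closure_rec_map: "0 \<le> c \<Longrightarrow> (*\<^sub>R) c ` K \<subseteq> K"
    and plus_closure_rec_map: "u \<in> U \<Longrightarrow> B u + K \<subseteq> closure (B u)"
proof -
  have "0 \<in> rec_map U B"
    by (auto simp: rec_map_def rec_cone_def elt_set_plus_def)
  then show "0 \<in> K"
    using K closure_subset by blast
  show "(*\<^sub>R) c ` K \<subseteq> K" if "0 \<le> c"
  proof -
    have "(*\<^sub>R) c ` rec_map U B \<subseteq> rec_map U B"
    proof (intro image_subsetI)
      fix y assume y: "y \<in> rec_map U B"
      have "t *\<^sub>R c *\<^sub>R y +o B u \<subseteq> B u" if "0 \<le> t" "u \<in> U" for t u
      proof -
        have "(t * c) *\<^sub>R y +o B u \<subseteq> B u"
          using y that mult_nonneg_nonneg[OF that(1) \<open>0 \<le> c\<close>]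
          unfolding rec_map_def rec_cone_def by blast
        then show ?thesis
          by simp
      qed
      then show "c *\<^sub>R y \<in> rec_map U B"
        unfolding rec_map_def rec_cone_def by blast
    qed
    then show ?thesis
      using scaleR_subset_closure[of K "rec_map U B" c] closure_mono K by blast
  qed
  show "B u + K \<subseteq> closure (B u)" if "u \<in> U"
  proof -
    have "y + b \<in> B u" if y: "y \<in> rec_map U B" and b: "b \<in> B u" for y b
    proof -
      have "1 *\<^sub>R y +o B u \<subseteq> B u"
        using y \<open>u \<in> U\<close> by (auto simp: rec_map_def rec_cone_def simp del: scaleR_one)
      then show ?thesis
        using b by (auto simp: elt_set_plus_def)
    qed
    then have "B u + rec_map U B \<subseteq> B u"
      by (force simp: set_plus_def add.commute)
    moreover have "B u + K \<subseteq> closure (B u + rec_map U B)"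
      by (intro plus_subset_closure) (simp_all add: closure_subset K)
    ultimately show ?thesis
      using closure_mono by blast
  qed
qed

text \<open>Homogeneous form of closed convexity: divide the weights by \<open>c + d\<close>, apply
  the definition, and scale back, using that \<open>K\<close> is stable under nonnegative
  scaling.\<close>

lemma closedly_convex_scaleR:
  fixes S :: "'b::real_tvs set"
  assumes S: "closedly_convex K S" and K: "0 \<in> K" "\<And>c. 0 \<le> c \<Longrightarrow> (*\<^sub>R) c ` K \<subseteq> K"
    and c: "0 \<le> c" "0 \<le> d"
  shows "(*\<^sub>R) c ` S + (*\<^sub>R) d ` S \<subseteq> closure ((*\<^sub>R) (c + d) ` S + K)"
proof (cases "c + d = 0 \<or> S = {}")
  case True
  \<comment> \<open>Here \<open>0\<close> is the set \<open>{0}\<close>, which is the left-hand side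
    when both weights vanish and \<open>S\<close> is nonempty.\<close>
  have "0 \<subseteq> closure K"
    using K(1) closure_subset by (auto simp: set_zero)
  moreover have "S = {} \<or> c = 0 \<and> d = 0"
    using True c by linarith
  ultimately show ?thesis
    by (cases "S = {}") (auto simp: image_constant_conv simp flip: set_zero)
next
  case False
  define s where "s = c / (c + d)"
  have s: "s \<in> {0..1}" "(c + d) * s = c" "(c + d) * (1 - s) = d"
    using False c by (auto simp: s_def field_simps)
  have "(*\<^sub>R) s ` S + (*\<^sub>R) (1 - s) ` S \<subseteq> closure (S + K)"
    using S s(1) by (auto simp: closedly_convex_def)
  from scaleR_subset_closure[OF this, of "c + d"]
  have "(*\<^sub>R) c ` S + (*\<^sub>R) d ` S \<subseteq> closure ((*\<^sub>R) (c + d) ` S + (*\<^sub>R) (c + d) ` K)"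
    by (simp only: scaleR_image_plus scaleR_image_scaleR s)
  also have "\<dots> \<subseteq> closure ((*\<^sub>R) (c + d) ` S + K)"
    using K(2)[of "c + d"] c by (intro closure_mono set_plus_mono2) auto
  finally show ?thesis .
qed

subsection \<open>The distance to the integers\<close>

lemma dist_int_nonneg: "0 \<le> dist_int t"
  unfolding dist_int_def by (rule cINF_greatest) auto

text \<open>An integer within \<open>1/2\<close> of \<open>t\<close> is a nearest one, since every
  other integer lies at distance at least \<open>1\<close> from it.\<close>

lemma dist_int_eqI:
  assumes "\<bar>of_int j - t\<bar> \<le> 1/2"
  shows "dist_int t = \<bar>of_int j - t\<bar>"
proof (rule antisym)
  show "dist_int t \<le> \<bar>of_int j - t\<bar>"
    unfolding dist_int_def by (rule cINF_lower) (auto intro!: bdd_belowI[where m = 0])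
  have "\<bar>of_int j - t\<bar> \<le> \<bar>of_int k - t\<bar>" for k
  proof (cases "k = j")
    case False
    then have "1 \<le> \<bar>of_int (k - j) :: real\<bar>"
      by linarith
    then show ?thesis
      using assms unfolding of_int_diff by linarith
  qed simp
  then show "\<bar>of_int j - t\<bar> \<le> dist_int t"
    unfolding dist_int_def by (intro cINF_greatest) auto
qed

text \<open>Between consecutive half-integers \<open>dist_int\<close> is affine: it rises with slope
  \<open>1\<close> from an integer if \<open>h\<close> is even, and falls with slope
  \<open>-1\<close> towards an integer if \<open>h\<close> is odd.\<close>

lemma dist_int_midpoint:
  assumes "of_int h / 2 \<le> a" "a \<le> b" "b \<le> (of_int h + 1) / 2"
  shows "dist_int ((a + b) / 2) = (dist_int a + dist_int b) / 2"
proof (cases "even h")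
  case True
  then obtain j where "h = 2 * j" by blast
  then have *: "dist_int s = s - of_int j" if "a \<le> s" "s \<le> b" for s
    using assms that dist_int_eqI[of j s] by simp
  show ?thesis
    using *[of a] *[of b] *[of "(a + b) / 2"] assms(2) by simp
next
  case False
  then obtain j where "h = 2 * j + 1" by (rule oddE)
  then have *: "dist_int s = of_int (j + 1) - s" if "a \<le> s" "s \<le> b" for s
    using assms that dist_int_eqI[of "j + 1" s] by (simp add: field_simps)
  show ?thesis
    using *[of a] *[of b] *[of "(a + b) / 2"] assms(2) by (simp add: field_simps)
qed

text \<open>For \<open>k < n\<close>, multiplication by \<open>2 ^ k\<close> sends two neighbours of
  level \<open>n\<close> into one interval between consecutive half-integers, where
  \<open>dist_int\<close> is affine.\<close>

lemma dist_int_dyadic_midpoint: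
  assumes "k < n"
  shows "2 * dist_int (2 ^ k * (of_int (2 * i + 1) / 2 ^ Suc n)) =
    1/2 * (2 * dist_int (2 ^ k * (of_int i / 2 ^ n)))
    + 1/2 * (2 * dist_int (2 ^ k * (of_int (i + 1) / 2 ^ n)))"
proof -
  define p where "p = n - Suc k"
  have n: "n = Suc (k + p)"
    using assms by (simp add: p_def)
  define h where "h = i div 2 ^ p"
  \<comment> \<open>The remainder of \<open>i\<close> modulo \<open>2 ^ p\<close> is at most
    \<open>2 ^ p - 1\<close>, so even \<open>i + 1\<close> does not pass the next multiple of
    \<open>2 ^ p\<close>.\<close>
  have "h * 2 ^ p \<le> i" "i + 1 \<le> (h + 1) * 2 ^ p"
    using div_mult_mod_eq[of i "2 ^ p"] pos_mod_sign[of "2 ^ p" i] pos_mod_bound[of "2 ^ p" i]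
      zero_less_power[of "2::int" p]
    unfolding h_def distrib_right by linarith+
  then have "real_of_int (h * 2 ^ p) \<le> of_int i" "real_of_int (i + 1) \<le> of_int ((h + 1) * 2 ^ p)"
    by (simp_all only: of_int_le_iff)
  then have "of_int h / 2 \<le> (of_int i / (2 * 2 ^ p) :: real)"
    "(of_int (i + 1) / (2 * 2 ^ p) :: real) \<le> (of_int h + 1) / 2"
    by (simp_all add: field_simps)
  moreover have "2 ^ k * (s / 2 ^ n) = s / (2 * 2 ^ p)" for s :: real
    by (simp add: n power_add)
  ultimately have "of_int h / 2 \<le> (2 ^ k * (of_int i / 2 ^ n) :: real)"
    "(2 ^ k * (of_int (i + 1) / 2 ^ n) :: real) \<le> (of_int h + 1) / 2"
    by simp_all
  moreover have "(2 ^ k * (of_int i / 2 ^ n) :: real) \<le> 2 ^ k * (of_int (i + 1) / 2 ^ n)"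
    by (simp add: field_simps)
  ultimately have "dist_int ((2 ^ k * (of_int i / 2 ^ n) + 2 ^ k * (of_int (i + 1) / 2 ^ n)) / 2) =
    (dist_int (2 ^ k * (of_int i / 2 ^ n)) + dist_int (2 ^ k * (of_int (i + 1) / 2 ^ n))) / 2"
    by (intro dist_int_midpoint)
  moreover have "(2 ^ k * (of_int i / 2 ^ n) + 2 ^ k * (of_int (i + 1) / 2 ^ n)) / 2 =
    (2 ^ k * (of_int (2 * i + 1) / 2 ^ Suc n) :: real)"
    by (simp add: field_simps)
  ultimately show ?thesis
    by (simp only:) (simp add: add_divide_distrib)
qed

lemma dist_int_dyadic_eq_0:
  assumes "n \<le> k"
  shows "dist_int (2 ^ k * (of_int m / 2 ^ n)) = 0"
proof -
  have "(2::real) ^ k = 2 ^ (k - n) * 2 ^ n"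
    using assms by (simp flip: power_add)
  then have "2 ^ k * (of_int m / 2 ^ n) = (of_int (2 ^ (k - n) * m) :: real)"
    by simp
  then show ?thesis
    by (metis Ints_of_int dist_int_eq_0)
qed

subsection \<open>Finite Tabor sums\<close>

lemma tabor_term_dyadic_eq_0:
  assumes "n \<le> k" "S (u /\<^sub>R 2 ^ k) \<noteq> {}"
  shows "tabor_term S (of_int m / 2 ^ n) u k = 0"
  unfolding tabor_term_def dist_int_dyadic_eq_0[OF assms(1)] mult_zero_right
  by (rule zero_scaleR_image[OF assms(2)])

text \<open>An odd numerator makes \<open>2 ^ n * t\<close> a half-integer, so the weight is
  \<open>2 * (1/2) = 1\<close>, the coefficient of \<open>A (x - y)\<close> in the assumed
  inclusion.\<close>

lemma tabor_term_dyadic_last: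
  "tabor_term S (of_int (2 * i + 1) / 2 ^ Suc n) u n = S (u /\<^sub>R 2 ^ n)"
proof -
  have "2 ^ n * (of_int (2 * i + 1) / 2 ^ Suc n) = (of_int i + 1/2 :: real)"
    by (simp add: field_simps)
  moreover have "2 * dist_int (of_int i + 1/2) = 1"
    using dist_int_eqI[of i "of_int i + 1/2"] by simp
  ultimately show ?thesis
    by (simp only: tabor_term_def) simp
qed

text \<open>All terms from index \<open>n\<close> on are \<open>{0}\<close>. The free bound
  \<open>N\<close> allows partial sums of different lengths to be compared through the
  series.\<close>

lemma tabor_series_dyadic:
  assumes "\<And>k::nat. S (u /\<^sub>R 2 ^ k) \<noteq> {}" "n \<le> N"
  shows "tabor_series S (of_int m / 2 ^ n) u = (\<Sum>k<N. tabor_term S (of_int m / 2 ^ n) u k)"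
  unfolding tabor_series_def
proof (rule Sum_any.expand_superset)
  show "{k. tabor_term S (of_int m / 2 ^ n) u k \<noteq> 0} \<subseteq> {..<N}"
    using assms tabor_term_dyadic_eq_0[of n _ S u m] by (force simp del: set_zero)
qed simp

text \<open>Shrinking \<open>x - y\<close> amounts to moving the second point from \<open>y\<close>
  towards \<open>x\<close> along the segment, which stays in \<open>D\<close>.\<close>

lemma difference_set_halving:
  assumes "convex D" "x \<in> D" "y \<in> D"
  shows "(x - y) /\<^sub>R 2 ^ k \<in> difference_set D"
proof -
  define z where "z = (1 / 2 ^ k) *\<^sub>R y + (1 - 1 / 2 ^ k) *\<^sub>R x"
  have "z \<in> D"
    unfolding z_def using assms by (intro convexD) auto
  moreover have "(x - y) /\<^sub>R 2 ^ k = x - z"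
    by (simp add: z_def algebra_simps divide_inverse)
  ultimately show ?thesis
    using assms(2) by (auto simp: difference_set_def)
qed

text \<open>\<open>K\<close> enters only through stability under scaling, containing
  \<open>0\<close>, and absorption by \<open>B\<close>, and \<open>A\<close> is arbitrary, so that
  the result applies both to \<open>A\<close> and to its enlargement by \<open>K\<close>. The
  fraction for \<open>t\<close> may be unreduced.\<close>

lemma midconvex_dyadic_sum:
  fixes D :: "'a::real_vector set" and A B F :: "'a \<Rightarrow> 'b::real_tvs set"
  assumes D: "convex D" "x \<in> D" "y \<in> D"
    and A: "\<And>u. u \<in> difference_set D \<Longrightarrow> A u \<noteq> {}"
    and B: "\<And>u. u \<in> difference_set D \<Longrightarrow> B u \<noteq> {}"
    and F: "\<And>x. x \<in> D \<Longrightarrow> F x \<noteq> {}"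
    and K: "0 \<in> K" "\<And>c. 0 \<le> c \<Longrightarrow> (*\<^sub>R) c ` K \<subseteq> K"
    and BK: "\<And>u. u \<in> difference_set D \<Longrightarrow> B u + K \<subseteq> closure (B u)"
    and cvx: "\<And>u. u \<in> difference_set D \<Longrightarrow> closedly_convex K (B u)"
    and mid: "\<And>x y. x \<in> D \<Longrightarrow> y \<in> D \<Longrightarrow>
      (*\<^sub>R) (1/2) ` (F x + F y) + A (x - y) \<subseteq> closure (F ((1/2) *\<^sub>R (x + y)) + B (x - y))"
    and t: "t = of_int m / 2 ^ n" "t \<in> {0..1}"
  shows "(*\<^sub>R) t ` F x + (*\<^sub>R) (1 - t) ` F y + (\<Sum>k<n. tabor_term A t (x - y) k)
    \<subseteq> closure (F (t *\<^sub>R x + (1 - t) *\<^sub>R y) + (\<Sum>k<n. tabor_term B t (x - y) k))"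
  using t
proof (induction n arbitrary: t m)
  case 0
  then have "t = 0 \<or> t = 1"
    by auto
  then show ?case
    using D F closure_subset[of "F x"] closure_subset[of "F y"]
    by (elim disjE) (simp_all add: image_constant_conv flip: set_zero)
next
  case (Suc n)
  define u where "u = x - y"
  have half: "u /\<^sub>R 2 ^ k \<in> difference_set D" for k
    using D unfolding u_def by (rule difference_set_halving)
  show ?case
  proof (cases "even m")
    \<comment> \<open>The fraction reduces to level \<open>n\<close>, and the extra term with index
      \<open>n\<close> is \<open>{0}\<close> on both sides.\<close>
    case True
    then obtain i where "m = 2 * i" by blast
    then have t: "t = of_int i / 2 ^ n"
      using Suc.prems by simp
    have "tabor_term A t u n = 0" "tabor_term B t u n = 0"
      unfolding t using A B half by (simp_all add: tabor_term_dyadic_eq_0 del: set_zero)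
    then show ?thesis
      using Suc.IH[OF t Suc.prems(2)] by (simp add: u_def del: set_zero)
  next
    case False
    then obtain i where m: "m = 2 * i + 1" by (rule oddE)
    have t: "t = of_int (2 * i + 1) / 2 ^ Suc n"
      using Suc.prems m by simp
    define a b where "a = (of_int i / 2 ^ n :: real)" and "b = (of_int (i + 1) / 2 ^ n :: real)"
    have ab: "t = 1/2 * a + 1/2 * b" "b - a = 1 / 2 ^ n"
      by (simp_all add: t a_def b_def field_simps)
    have "0 \<le> t * 2 ^ Suc n" "t * 2 ^ Suc n \<le> 2 ^ Suc n"
      using Suc.prems(2) by (auto intro: mult_left_le_one_le)
    then have "0 \<le> real_of_int (2 * i + 1)" "real_of_int (2 * i + 1) \<le> of_int (2 * 2 ^ n)"
      unfolding t by simp_all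
    \<comment> \<open>Parity sharpens the bounds on \<open>2 * i + 1\<close>, so that both
      neighbours \<open>a\<close> and \<open>b\<close> stay in \<open>[0, 1]\<close>.\<close>
    then have "0 \<le> i" "i + 1 \<le> 2 ^ n"
      unfolding of_int_le_iff of_int_0_le_iff by presburger+
    then have "0 \<le> real_of_int i" "real_of_int (i + 1) \<le> of_int (2 ^ n)"
      unfolding of_int_le_iff of_int_0_le_iff .
    then have "0 \<le> a" "b \<le> 1"
      by (simp_all add: a_def b_def)
    moreover have "a \<le> b"
      using ab(2) by (simp add: algebra_simps)
    ultimately have ab01: "a \<in> {0..1}" "b \<in> {0..1}"
      by auto
    define p where "p = (\<lambda>s. s *\<^sub>R x + (1 - s) *\<^sub>R y)"
    have pD: "p s \<in> D" if "s \<in> {0..1}" for s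
      unfolding p_def using D that by (intro convexD) auto
    have p: "p s = y + s *\<^sub>R u" for s
      by (simp add: p_def u_def algebra_simps)
    have "(1/2) *\<^sub>R (p b + p a) = (1/2) *\<^sub>R (y + y) + (1/2 * a + 1/2 * b) *\<^sub>R u"
      unfolding p scaleR_add_left scaleR_add_right scaleR_scaleR by (simp only: ac_simps)
    then have p_mid: "p t = (1/2) *\<^sub>R (p b + p a)"
      by (simp only: p ab(1) scaleR_half_double)
    \<comment> \<open>\<open>p b\<close> is taken as the first point so that the difference is a
      positive multiple of \<open>u\<close>; no symmetry of \<open>A\<close> or \<open>B\<close> is
      available.\<close>
    have "p b - p a = (b - a) *\<^sub>R u"
      by (simp add: p scaleR_diff_left)
    then have p_diff: "p b - p a = u /\<^sub>R 2 ^ n"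
      by (simp add: ab divide_inverse)
    let ?h = "(*\<^sub>R) (1/2) :: 'b \<Rightarrow> 'b"
    let ?A = "\<lambda>s. \<Sum>k<n. tabor_term A s u k" and ?B = "\<lambda>s. \<Sum>k<n. tabor_term B s u k"
    have IH: "(*\<^sub>R) s ` F x + (*\<^sub>R) (1 - s) ` F y + ?A s \<subseteq> closure (F (p s) + ?B s)"
      if "s = a \<or> s = b" for s
      using that Suc.IH[of a i] Suc.IH[of b "i + 1"] ab01 by (auto simp: a_def b_def u_def p_def)
    have split: "(*\<^sub>R) (1/2 * c + 1/2 * d) ` S \<subseteq> ?h ` (*\<^sub>R) c ` S + ?h ` (*\<^sub>R) d ` S"
      for c d and S :: "'b set"
      unfolding scaleR_image_scaleR by (rule scaleR_add_image_subset)
    have last: "tabor_term S t u n = S (u /\<^sub>R 2 ^ n)" for S :: "'a \<Rightarrow> 'b set"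
      unfolding t by (rule tabor_term_dyadic_last)
    have coeff: "2 * dist_int (2 ^ k * t)
        = 1/2 * (2 * dist_int (2 ^ k * a)) + 1/2 * (2 * dist_int (2 ^ k * b))" if "k < n" for k
      unfolding t a_def b_def using that by (rule dist_int_dyadic_midpoint)
    have t': "1 - t = 1/2 * (1 - a) + 1/2 * (1 - b)"
      by (simp add: ab(1) field_simps)
    have splitF: "(*\<^sub>R) t ` F x \<subseteq> ?h ` (*\<^sub>R) a ` F x + ?h ` (*\<^sub>R) b ` F x"
      "(*\<^sub>R) (1 - t) ` F y \<subseteq> ?h ` (*\<^sub>R) (1 - a) ` F y + ?h ` (*\<^sub>R) (1 - b) ` F y"
      unfolding t' unfolding ab(1) by (rule split)+
    have sumA: "?A t \<subseteq> ?h ` ?A a + ?h ` ?A b"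
      unfolding scaleR_image_sum sum.distrib[symmetric]
    proof (rule sum_set_mono)
      show "tabor_term A t u k \<subseteq> ?h ` tabor_term A a u k + ?h ` tabor_term A b u k"
        if "k \<in> {..<n}" for k
        unfolding tabor_term_def coeff[OF that[unfolded lessThan_iff]] by (rule split)
    qed
    have "(*\<^sub>R) t ` F x + (*\<^sub>R) (1 - t) ` F y + (\<Sum>k<Suc n. tabor_term A t u k)
        = (*\<^sub>R) t ` F x + (*\<^sub>R) (1 - t) ` F y + (?A t + A (u /\<^sub>R 2 ^ n))"
      by (simp only: sum.lessThan_Suc last)
    also have "\<dots> \<subseteq> (?h ` (*\<^sub>R) a ` F x + ?h ` (*\<^sub>R) b ` F x)
        + (?h ` (*\<^sub>R) (1 - a) ` F y + ?h ` (*\<^sub>R) (1 - b) ` F y)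
        + ((?h ` ?A a + ?h ` ?A b) + A (u /\<^sub>R 2 ^ n))"
      by (intro set_plus_mono2 splitF sumA order_refl)
    also have "\<dots> = ?h ` ((*\<^sub>R) b ` F x + (*\<^sub>R) (1 - b) ` F y + ?A b)
        + ?h ` ((*\<^sub>R) a ` F x + (*\<^sub>R) (1 - a) ` F y + ?A a) + A (u /\<^sub>R 2 ^ n)"
      by (simp only: scaleR_image_plus ac_simps)
    finally have left1: "(*\<^sub>R) t ` F x + (*\<^sub>R) (1 - t) ` F y + (\<Sum>k<Suc n. tabor_term A t u k)
        \<subseteq> ?h ` ((*\<^sub>R) b ` F x + (*\<^sub>R) (1 - b) ` F y + ?A b)
        + ?h ` ((*\<^sub>R) a ` F x + (*\<^sub>R) (1 - a) ` F y + ?A a) + A (u /\<^sub>R 2 ^ n)" .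
    \<comment> \<open>The right-hand sides of the two halved induction hypotheses are regrouped to
      expose the left-hand side of \<open>mid\<close> for \<open>p b\<close> and
      \<open>p a\<close>.\<close>
    have "(?h ` (F (p b) + F (p a)) + A (p b - p a)) + (?h ` ?B a + ?h ` ?B b)
        = ?h ` (F (p b) + ?B b) + ?h ` (F (p a) + ?B a) + A (u /\<^sub>R 2 ^ n)"
      by (simp only: scaleR_image_plus ac_simps p_diff)
    moreover have "?h ` ((*\<^sub>R) b ` F x + (*\<^sub>R) (1 - b) ` F y + ?A b)
        + ?h ` ((*\<^sub>R) a ` F x + (*\<^sub>R) (1 - a) ` F y + ?A a) + A (u /\<^sub>R 2 ^ n)
        \<subseteq> closure (?h ` (F (p b) + ?B b) + ?h ` (F (p a) + ?B a) + A (u /\<^sub>R 2 ^ n))"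
      by (intro plus_subset_closure scaleR_subset_closure IH closure_subset disjI1 disjI2 refl)
    ultimately have left: "(*\<^sub>R) t ` F x + (*\<^sub>R) (1 - t) ` F y + (\<Sum>k<Suc n. tabor_term A t u k)
        \<subseteq> closure ((?h ` (F (p b) + F (p a)) + A (p b - p a)) + (?h ` ?B a + ?h ` ?B b))"
      using left1 by (simp only: subset_trans)
    have "(?h ` (F (p b) + F (p a)) + A (p b - p a)) + (?h ` ?B a + ?h ` ?B b)
        \<subseteq> closure ((F (p t) + B (u /\<^sub>R 2 ^ n)) + (?h ` ?B a + ?h ` ?B b))"
      using mid[OF pD pD, OF ab01(2,1)] unfolding p_mid[symmetric] p_diff
      by (rule plus_subset_closure[OF _ closure_subset])
    \<comment> \<open>The older \<open>B\<close>-terms are merged by closed convexity; the newest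
      one, \<open>B (u /\<^sub>R 2 ^ n)\<close>, absorbs the resulting copies of
      \<open>K\<close>.\<close>
    moreover have "(F (p t) + B (u /\<^sub>R 2 ^ n)) + (?h ` ?B a + ?h ` ?B b)
        \<subseteq> closure ((F (p t) + B (u /\<^sub>R 2 ^ n)) + ?B t)"
      unfolding scaleR_image_sum sum.distrib[symmetric]
    proof (rule absorb_sum)
      show "F (p t) + B (u /\<^sub>R 2 ^ n) + K \<subseteq> closure (F (p t) + B (u /\<^sub>R 2 ^ n))"
        unfolding add.assoc by (intro plus_subset_closure closure_subset BK half)
      show "?h ` tabor_term B a u k + ?h ` tabor_term B b u k \<subseteq> closure (tabor_term B t u k + K)"
        if "k < n" for k
        unfolding tabor_term_def coeff[OF that] scaleR_image_scaleR
        by (intro closedly_convex_scaleR cvx half K) (auto simp: dist_int_nonneg)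
    qed
    moreover have "(F (p t) + B (u /\<^sub>R 2 ^ n)) + ?B t = F (p t) + (\<Sum>k<Suc n. tabor_term B t u k)"
      by (simp only: sum.lessThan_Suc last ac_simps)
    ultimately have "(*\<^sub>R) t ` F x + (*\<^sub>R) (1 - t) ` F y + (\<Sum>k<Suc n. tabor_term A t u k)
        \<subseteq> closure (F (p t) + (\<Sum>k<Suc n. tabor_term B t u k))"
      using subset_closure_trans[OF left subset_closure_trans] by (simp only:)
    then show ?thesis
      unfolding u_def p_def .
  qed
qed

section \<open>From finite sums to the series and the Tabor transforms\<close>

theorem theorem1:
  fixes D :: "'a::real_vector set"
    and A B F :: "'a \<Rightarrow> 'b::{real_tvs, t2_space} set"
    and K :: "'b set"
  assumes "D \<noteq> {}" and "convex D"
    and "\<And>u. u \<in> difference_set D \<Longrightarrow> A u \<noteq> {}"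
    and "\<And>u. u \<in> difference_set D \<Longrightarrow> B u \<noteq> {}"
    and "\<And>x. x \<in> D \<Longrightarrow> F x \<noteq> {}"
    and "K = closure (rec_map (difference_set D) B)"
    and "\<And>u. u \<in> difference_set D \<Longrightarrow> closedly_convex K (B u)"
    and "\<And>x y. x \<in> D \<Longrightarrow> y \<in> D \<Longrightarrow>
      (*\<^sub>R) (1/2) ` (F x + F y) + A (x - y)
        \<subseteq> closure (F ((1/2) *\<^sub>R (x + y)) + B (x - y))"
  shows "(\<forall>x\<in>D. \<forall>y\<in>D. \<forall>t \<in> dyadic_rationals \<inter> {0..1}.
            (*\<^sub>R) t ` F x + (*\<^sub>R) (1 - t) ` F y + tabor_series A t (x - y)
              \<subseteq> closure (F (t *\<^sub>R x + (1 - t) *\<^sub>R y) + tabor_series B t (x - y)))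
       \<and> ((\<forall>u \<in> difference_set D. 0 \<in> closure (A u + K)) \<longrightarrow>
          (\<forall>x\<in>D. \<forall>y\<in>D. \<forall>t \<in> dyadic_rationals \<inter> {0..1}.
            (*\<^sub>R) t ` F x + (*\<^sub>R) (1 - t) ` F y + tabor_transform A t (x - y)
              \<subseteq> closure (F (t *\<^sub>R x + (1 - t) *\<^sub>R y) + tabor_transform B t (x - y))))"
proof -
  note D = assms(2) and A = assms(3) and B = assms(4) and F = assms(5)
    and cvx = assms(7) and mid = assms(8)
  note K = closure_rec_map[OF assms(6)]
  have half: "(x - y) /\<^sub>R 2 ^ k \<in> difference_set D" if "x \<in> D" "y \<in> D" for x y k
    using D that by (rule difference_set_halving)
  have "(*\<^sub>R) t ` F x + (*\<^sub>R) (1 - t) ` F y + tabor_series A t (x - y)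
      \<subseteq> closure (F (t *\<^sub>R x + (1 - t) *\<^sub>R y) + tabor_series B t (x - y))"
    if xy: "x \<in> D" "y \<in> D" and "t \<in> dyadic_rationals \<inter> {0..1}" for x y t
  proof -
    obtain m :: int and n :: nat where t: "t = of_int m / 2 ^ n" "t \<in> {0..1}"
      using \<open>t \<in> dyadic_rationals \<inter> {0..1}\<close> by (auto simp: dyadic_rationals_def)
    have "tabor_series S t (x - y) = (\<Sum>k<n. tabor_term S t (x - y) k)" if "S = A \<or> S = B" for S
      unfolding t using A B half[OF xy] that by (intro tabor_series_dyadic) auto
    then show ?thesis
      using midconvex_dyadic_sum[where A = A and B = B, OF D xy A B F K cvx mid t] by simp
  qed
  moreover have "(*\<^sub>R) t ` F x + (*\<^sub>R) (1 - t) ` F y + tabor_transform A t (x - y)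
      \<subseteq> closure (F (t *\<^sub>R x + (1 - t) *\<^sub>R y) + tabor_transform B t (x - y))"
    if zero: "\<forall>u \<in> difference_set D. 0 \<in> closure (A u + K)"
      and xy: "x \<in> D" "y \<in> D" and "t \<in> dyadic_rationals \<inter> {0..1}" for x y t
  proof -
    obtain m :: int and n :: nat where t: "t = of_int m / 2 ^ n" "t \<in> {0..1}"
      using \<open>t \<in> dyadic_rationals \<inter> {0..1}\<close> by (auto simp: dyadic_rationals_def)
    define A' where "A' = (\<lambda>u. closure (A u + K))"
    have A': "A' u \<noteq> {}" "0 \<in> A' u" if "u \<in> difference_set D" for u
      using zero that by (auto simp: A'_def)
    have AA': "A u \<subseteq> A' u" for u
      using set_zero_plus2[OF K(1), of "A u"] closure_subset[of "A u + K"]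
      by (auto simp: A'_def add.commute)
    \<comment> \<open>The \<open>K\<close> added on the left is carried over to the right, where
      \<open>B (x - y)\<close> absorbs it.\<close>
    have mid': "(*\<^sub>R) (1/2) ` (F x + F y) + A' (x - y)
        \<subseteq> closure (F ((1/2) *\<^sub>R (x + y)) + B (x - y))" if "x \<in> D" "y \<in> D" for x y
    proof -
      have "x - y \<in> difference_set D"
        using that by (auto simp: difference_set_def)
      then have "(F ((1/2) *\<^sub>R (x + y)) + B (x - y)) + K
          \<subseteq> closure (F ((1/2) *\<^sub>R (x + y)) + B (x - y))"
        unfolding add.assoc by (intro plus_subset_closure closure_subset K)
      moreover have "((*\<^sub>R) (1/2) ` (F x + F y) + A (x - y)) + K
          \<subseteq> closure ((F ((1/2) *\<^sub>R (x + y)) + B (x - y)) + K)"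
        by (intro plus_subset_closure closure_subset mid that)
      moreover have "(*\<^sub>R) (1/2) ` (F x + F y) + A' (x - y)
          \<subseteq> closure ((*\<^sub>R) (1/2) ` (F x + F y) + (A (x - y) + K))"
        unfolding A'_def by (intro plus_subset_closure closure_subset order_refl)
      ultimately show ?thesis
        unfolding add.assoc by (meson subset_closure_trans)
    qed
    have "(\<Sum>k\<le>N. tabor_term A t (x - y) k) \<subseteq> (\<Sum>k<n. tabor_term A' t (x - y) k)" for N
    proof -
      have "(\<Sum>k\<le>N. tabor_term A t (x - y) k) \<subseteq> (\<Sum>k\<le>N. tabor_term A' t (x - y) k)"
        unfolding tabor_term_def by (intro sum_set_mono image_mono AA')
      \<comment> \<open>The bound \<open>Suc N + n\<close> covers the indices up to \<open>N\<close>
        and is at least \<open>n\<close>. The sum can therefore be enlarged to it because the terms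
        contain \<open>0\<close>, then cut back to \<open>n\<close> because the later terms vanish,
        giving a bound independent of \<open>N\<close>.\<close>
      also have "\<dots> \<subseteq> (\<Sum>k<Suc N + n. tabor_term A' t (x - y) k)"
      proof (rule sum_set_subset_superset)
        show "0 \<in> tabor_term A' t (x - y) k" for k
          using A'(2)[OF half[OF xy]] unfolding tabor_term_def by (metis image_eqI scaleR_zero_right)
      qed auto
      also have "\<dots> = tabor_series A' t (x - y)"
        unfolding t using A'(1) half[OF xy] by (intro tabor_series_dyadic[symmetric]) auto
      also have "\<dots> = (\<Sum>k<n. tabor_term A' t (x - y) k)"
        unfolding t using A'(1) half[OF xy] by (intro tabor_series_dyadic) auto
      finally show ?thesis .
    qed
    then have "tabor_transform A t (x - y) \<subseteq> closure (\<Sum>k<n. tabor_term A' t (x - y) k)"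
      unfolding tabor_transform_def by (intro closure_mono UN_least)
    then have "(*\<^sub>R) t ` F x + (*\<^sub>R) (1 - t) ` F y + tabor_transform A t (x - y)
        \<subseteq> closure ((*\<^sub>R) t ` F x + (*\<^sub>R) (1 - t) ` F y + (\<Sum>k<n. tabor_term A' t (x - y) k))"
      by (intro plus_subset_closure closure_subset)
    moreover have "(*\<^sub>R) t ` F x + (*\<^sub>R) (1 - t) ` F y + (\<Sum>k<n. tabor_term A' t (x - y) k)
        \<subseteq> closure (F (t *\<^sub>R x + (1 - t) *\<^sub>R y) + (\<Sum>k<n. tabor_term B t (x - y) k))"
      using midconvex_dyadic_sum[where A = A' and B = B, OF D xy A'(1) B F K cvx mid' t] .
    moreover have "(\<Sum>k<n. tabor_term B t (x - y) k) \<subseteq> tabor_transform B t (x - y)"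
    proof -
      have "(\<Sum>k<n. tabor_term B t (x - y) k) = tabor_series B t (x - y)"
        unfolding t using B half[OF xy] by (intro tabor_series_dyadic[symmetric]) auto
      \<comment> \<open>The term with index \<open>n\<close> is \<open>{0}\<close>; including it
        gives a member of the union that defines the transform.\<close>
      also have "\<dots> = (\<Sum>k\<le>n. tabor_term B t (x - y) k)"
        unfolding t lessThan_Suc_atMost[symmetric]
        using B half[OF xy] by (intro tabor_series_dyadic) auto
      also have "\<dots> \<subseteq> tabor_transform B t (x - y)"
        unfolding tabor_transform_def by (rule subset_trans[OF UN_upper closure_subset]) simp
      finally show ?thesis .
    qed
    then have "F (t *\<^sub>R x + (1 - t) *\<^sub>R y) + (\<Sum>k<n. tabor_term B t (x - y) k)
        \<subseteq> closure (F (t *\<^sub>R x + (1 - t) *\<^sub>R y) + tabor_transform B t (x - y))"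
      by (intro plus_subset_closure closure_subset subset_trans[OF _ closure_subset])
    ultimately show ?thesis
      by (meson subset_closure_trans)
  qed
  ultimately show ?thesis
    by blast
qed

end
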